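(* Let $a,b,c,d$ be elements of a unital associative algebra over $\mathbb C$, and for $\lambda\in\mathbb C\setminus\{0\}$ put $$\mathrm g(\lambda)=\begin{pmatrix} a & \lambda b\\ \lambda^{-1}c & d\end{pmatrix},\qquad \hat{\mathrm g}(\lambda)=\begin{pmatrix}\lambda^{-1}c & \lambda^{-1}d\\ \lambda a & \lambda b\end{pmatrix}.$$ Each of the following matrix relations (required for all $\lambda,\mu\in\mathbb C\setminus\{0\}$) $$R_{12}(\lambda)\,\mathrm g_{13}(\lambda\mu)\,\mathrm g_{23}(\mu)=\mathrm g_{23}(\mu)\,\mathrm g_{13}(\lambda\mu)\,R_{12}(\lambda),$$ $$\hat R_{12}(\lambda)\,\hat{\mathrm g}_{13}(\lambda\mu)\,\hat{\mathrm g}_{23}(\mu)=\hat{\mathrm g}_{23}(\mu)\,\hat{\mathrm g}_{13}(\lambda\mu)\,\hat R_{12}(\lambda)$$ holds if and only if $a,b,c,d$ satisfy the defining relations of $GL_q(2)$: $$[a,d]=(q-q^{-1})\,bc,\quad [b,c]=0,\quad ab=q\,ba,\quad ac=q\,ca,\quad bd=q\,db,\quad cd=q\,dc.$$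
   Context: Let $\gamma\in(0,\pi)$, $q=e^{i\gamma}$, and $\varpi(\lambda)=\lambda-\lambda^{-1}$. In the basis $e_1\otimes e_1,e_1\otimes e_2,e_2\otimes e_1,e_2\otimes e_2$ of $\mathbb C^2\otimes\mathbb C^2$, $$R(\lambda)=\begin{pmatrix}\varpi(q\lambda)&0&0&0\\0&\varpi(\lambda)&\varpi(q)&0\\0&\varpi(q)&\varpi(\lambda)&0\\0&0&0&\varpi(q\lambda)\end{pmatrix},\qquad \hat R(\lambda)=\begin{pmatrix}\varpi(q\lambda)&0&0&0\\0&\varpi(\lambda)&\lambda^{-1}\varpi(q)&0\\0&\lambda\varpi(q)&\varpi(\lambda)&0\\0&0&0&\varpi(q\lambda)\end{pmatrix}.$$ Subscripts indicate nontrivial tensor components in $\mathrm{Mat}(2)\otimes\mathrm{Mat}(2)\otimes\mathcal A$, where $\mathcal A$ is the algebra containing $a,b,c,d$: $R_{12}=R\otimes1$, $\mathrm g_{13}=\sum E_{ij}\otimes1\otimes\mathrm g_{ij}$, $\mathrm g_{23}=\sum1\otimes E_{ij}\otimes\mathrm g_{ij}$. *)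

theory Defs
  imports Complex_Main "Jordan_Normal_Form.Matrix"
begin

text \<open>
  The sort \<open>{ring, monoid_mult}\<close> is that of unital, not necessarily commutative rings; unlike
  \<open>ring_1\<close> it does not impose \<open>0 \<noteq> 1\<close>, so that the zero algebra is included.
\<close>

locale complex_algebra = vector_space scale
  for scale :: "complex \<Rightarrow> 'a::{ring, monoid_mult} \<Rightarrow> 'a" +
  assumes scale_mult_left: "scale z x * y = scale z (x * y)"
    and scale_mult_right: "x * scale z y = scale z (x * y)"

definition commutator :: "'a::ring \<Rightarrow> 'a \<Rightarrow> 'a" where
  "commutator x y = x * y - y * x"

definition varpi :: "complex \<Rightarrow> complex" where
  "varpi z = z - inverse z"

definition R_mat :: "complex \<Rightarrow> complex \<Rightarrow> complex mat" where
  "R_mat q l = mat_of_rows_list 4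
    [[varpi (q * l), 0,       0,       0],
     [0,             varpi l, varpi q, 0],
     [0,             varpi q, varpi l, 0],
     [0,             0,       0,       varpi (q * l)]]"

definition R_hat :: "complex \<Rightarrow> complex \<Rightarrow> complex mat" where
  "R_hat q l = mat_of_rows_list 4
    [[varpi (q * l), 0,           0,                   0],
     [0,             varpi l,     inverse l * varpi q, 0],
     [0,             l * varpi q, varpi l,             0],
     [0,             0,           0,                   varpi (q * l)]]"

text \<open>
  \<open>Mat(2) \<otimes> Mat(2) \<otimes> A\<close> is identified with the \<open>4 \<times> 4\<close> matrices over \<open>A\<close>, where
  \<open>E\<^sub>i\<^sub>j \<otimes> E\<^sub>k\<^sub>l \<otimes> x\<close> has the single nonzero entry \<open>x\<close> in row \<open>2 i + k\<close> and column \<open>2 j + l\<close>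
  (indices counted from 0). This is the ordering
  \<open>e\<^sub>1 \<otimes> e\<^sub>1, e\<^sub>1 \<otimes> e\<^sub>2, e\<^sub>2 \<otimes> e\<^sub>1, e\<^sub>2 \<otimes> e\<^sub>2\<close> of the basis; hence
  \<open>\<Sum> E\<^sub>i\<^sub>j \<otimes> 1 \<otimes> g\<^sub>i\<^sub>j\<close> and \<open>\<Sum> 1 \<otimes> E\<^sub>i\<^sub>j \<otimes> g\<^sub>i\<^sub>j\<close> are Kronecker products with the identity matrix.
\<close>

definition kronecker :: "'a::times mat \<Rightarrow> 'a mat \<Rightarrow> 'a mat" where
  "kronecker A B = mat (dim_row A * dim_row B) (dim_col A * dim_col B)
    (\<lambda>(r, s). A $$ (r div dim_row B, s div dim_col B) * B $$ (r mod dim_row B, s mod dim_col B))"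

definition leg13 :: "'a::{ring, monoid_mult} mat \<Rightarrow> 'a mat" where
  "leg13 g = kronecker g (1\<^sub>m 2)"

definition leg23 :: "'a::{ring, monoid_mult} mat \<Rightarrow> 'a mat" where
  "leg23 g = kronecker (1\<^sub>m 2) g"

definition leg12 ::
    "(complex \<Rightarrow> 'a \<Rightarrow> 'a) \<Rightarrow> complex mat \<Rightarrow> 'a::{ring, monoid_mult} mat" where
  "leg12 scale R = map_mat (\<lambda>z. scale z 1) R"

definition g_mat ::
    "(complex \<Rightarrow> 'a \<Rightarrow> 'a) \<Rightarrow> 'a \<Rightarrow> 'a \<Rightarrow> 'a \<Rightarrow> 'a \<Rightarrow> complex \<Rightarrow> 'a::{ring, monoid_mult} mat" where
  "g_mat scale a b c d l = mat_of_rows_list 2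
    [[a,                   scale l b],
     [scale (inverse l) c, d]]"

definition g_hat ::
    "(complex \<Rightarrow> 'a \<Rightarrow> 'a) \<Rightarrow> 'a \<Rightarrow> 'a \<Rightarrow> 'a \<Rightarrow> 'a \<Rightarrow> complex \<Rightarrow> 'a::{ring, monoid_mult} mat" where
  "g_hat scale a b c d l = mat_of_rows_list 2
    [[scale (inverse l) c, scale (inverse l) d],
     [scale l a,           scale l b]]"

definition GLq2_relations ::
    "(complex \<Rightarrow> 'a \<Rightarrow> 'a) \<Rightarrow> complex \<Rightarrow> 'a::{ring, monoid_mult} \<Rightarrow> 'a \<Rightarrow> 'a \<Rightarrow> 'a \<Rightarrow> bool" where
  "GLq2_relations scale q a b c d \<longleftrightarrow>
     commutator a d = scale (q - inverse q) (b * c) \<and>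
     commutator b c = 0 \<and>
     a * b = scale q (b * a) \<and>
     a * c = scale q (c * a) \<and>
     b * d = scale q (d * b) \<and>
     c * d = scale q (d * c)"

end

theory Submission
  imports Defs
begin

text \<open>
  Both \<open>R(\<lambda>)\<close> and \<open>R_hat(\<lambda>)\<close> conserve the number of indices equal to 2, so each entry of
  the products \<open>R g\<^sub>1\<^sub>3 g\<^sub>2\<^sub>3\<close> and \<open>g\<^sub>2\<^sub>3 g\<^sub>1\<^sub>3 R\<close> contains at most two terms, and each term is a
  scalar times a product of two of the generators. Of the 16 entry equations the four in the corners
  are identities such as \<open>a a = a a\<close>. Eight others involve a single pair of generators and have the form
  \<open>p x y = t y x + w x y\<close>, or the same with the roles of \<open>x y\<close> and \<open>y x\<close> interchanged. The
  \<open>\<lambda>\<close>-dependence disappears from them because of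
  \<open>\<varpi>(q \<lambda>) - \<lambda> \<varpi>(q) = q\<inverse> \<varpi>(\<lambda>)\<close> and \<open>\<varpi>(q \<lambda>) - \<lambda>\<inverse> \<varpi>(q) = q \<varpi>(\<lambda>)\<close>,
  which turn each of them, up to a nonzero scalar, into \<open>\<varpi>(\<lambda>)\<close> times the relation
  \<open>x y = q y x\<close>. The remaining four, in the central block, mix \<open>a d\<close>, \<open>d a\<close>, \<open>b c\<close>, \<open>c b\<close>. Two of them reduce to \<open>\<varpi>(\<lambda>)\<close> times
  \<open>b c = c b\<close>, since the \<open>\<varpi>(q)\<close> terms cancel; in the other two the difference of the
  \<open>\<varpi>(q)\<close> terms has coefficient \<open>\<varpi>(q) (\<lambda> - \<lambda>\<inverse>) = \<varpi>(q) \<varpi>(\<lambda>)\<close>, so they are \<open>\<varpi>(\<lambda>)\<close>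
  times \<open>[a, d] = (q - q\<inverse>) b c\<close>, the product on the right occurring once in each order.

  Hence for fixed \<open>\<lambda>\<close> and \<open>\<mu>\<close> the matrix relation is equivalent to: \<open>\<varpi>(\<lambda>) = 0\<close>, or the
  relations of \<open>GL\<^sub>q(2)\<close> hold (\<open>exchange_relation_g_mat_iff\<close> and \<open>exchange_relation_g_hat_iff\<close>).
  A single \<open>\<lambda>\<close> with \<open>\<lambda>\<^sup>2 \<noteq> 1\<close> therefore recovers all the relations, and conversely they imply
  the matrix relation for every \<open>\<lambda>\<close> and \<open>\<mu>\<close>.
\<close>

section \<open>Products of the two auxiliary legs\<close>

lemma less_4_cases: "i < (4::nat) \<Longrightarrow> i = 0 \<or> i = 1 \<or> i = 2 \<or> i = 3"
  by linarith

lemma sum_lessThan_4: "sum f {..<4::nat} = f 0 + f 1 + f 2 + f 3"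
  by (simp add: eval_nat_numeral)

text \<open>
  The matrix units of the two legs commute, so both products have a single term in each entry; only
  the order of the two noncommuting coefficients distinguishes them.
\<close>

lemma
  fixes G H :: "'a::{ring, monoid_mult} mat"
  assumes "G \<in> carrier_mat 2 2" and "H \<in> carrier_mat 2 2" and "r < 4" and "s < 4"
  shows leg13_mult_leg23:
      "(leg13 G * leg23 H) $$ (r, s) = G $$ (r div 2, s div 2) * H $$ (r mod 2, s mod 2)"
    and leg23_mult_leg13:
      "(leg23 H * leg13 G) $$ (r, s) = H $$ (r mod 2, s mod 2) * G $$ (r div 2, s div 2)"
proof -
  have carriers: "leg13 G \<in> carrier_mat 4 4" "leg23 H \<in> carrier_mat 4 4"
    using assms by (auto simp: leg13_def leg23_def kronecker_def)
  have leg13: "leg13 G $$ (i, j) = (if i mod 2 = j mod 2 then G $$ (i div 2, j div 2) else 0)"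
    and leg23: "leg23 H $$ (i, j) = (if i div 2 = j div 2 then H $$ (i mod 2, j mod 2) else 0)"
    if "i < 4" "j < 4" for i j
    using assms that by (auto simp: leg13_def leg23_def kronecker_def)
  have product: "(leg13 G * leg23 H) $$ (r, s) = (\<Sum>k<4. leg13 G $$ (r, k) * leg23 H $$ (k, s))"
    "(leg23 H * leg13 G) $$ (r, s) = (\<Sum>k<4. leg23 H $$ (r, k) * leg13 G $$ (k, s))"
    using carriers assms(3,4) by (simp_all add: scalar_prod_def atLeast0LessThan)
  show "(leg13 G * leg23 H) $$ (r, s) = G $$ (r div 2, s div 2) * H $$ (r mod 2, s mod 2)"
    unfolding product sum_lessThan_4 using less_4_cases[OF assms(3)] less_4_cases[OF assms(4)]
    by (elim disjE; hypsubst) (simp_all add: leg13 leg23)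
  show "(leg23 H * leg13 G) $$ (r, s) = H $$ (r mod 2, s mod 2) * G $$ (r div 2, s div 2)"
    unfolding product sum_lessThan_4 using less_4_cases[OF assms(3)] less_4_cases[OF assms(4)]
    by (elim disjE; hypsubst) (simp_all add: leg13 leg23)
qed

section \<open>The relation entry by entry\<close>

text \<open>
  The common shape of the two R-matrices: they differ only in the weights \<open>u\<close>, \<open>v\<close> of the two
  transitions \<open>e\<^sub>2 \<otimes> e\<^sub>1 \<mapsto> e\<^sub>1 \<otimes> e\<^sub>2\<close> and \<open>e\<^sub>1 \<otimes> e\<^sub>2 \<mapsto> e\<^sub>2 \<otimes> e\<^sub>1\<close>.
\<close>

definition six_vertex :: "'b::zero \<Rightarrow> 'b \<Rightarrow> 'b \<Rightarrow> 'b \<Rightarrow> 'b mat" where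
  "six_vertex p t u v = mat_of_rows_list 4 [[p, 0, 0, 0], [0, t, u, 0], [0, v, t, 0], [0, 0, 0, p]]"

lemma mat4_eq_iff:
  assumes "X \<in> carrier_mat 4 4" "Y \<in> carrier_mat 4 4"
  shows "X = Y \<longleftrightarrow> (\<forall>r\<in>{0,1,2,3}. \<forall>s\<in>{0,1,2,3}. X $$ (r, s) = Y $$ (r, s))"
proof
  assume *: "\<forall>r\<in>{0,1,2,3}. \<forall>s\<in>{0,1,2,3}. X $$ (r, s) = Y $$ (r, s)"
  show "X = Y"
  proof (rule eq_matI)
    fix r s assume "r < dim_row Y" "s < dim_col Y"
    then have "r \<in> {0,1,2,3}" "s \<in> {0,1,2,3}" using assms less_4_cases by auto
    then show "X $$ (r, s) = Y $$ (r, s)" using * by blast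
  qed (use assms in auto)
qed simp

context complex_algebra
begin

text \<open>
  The order of the equations groups them by the relations that they will yield: the corners come
  first, then the top row, the bottom row, the left column and the right column, and finally the
  central block.
\<close>

lemma leg12_six_vertex_intertwines_iff:
  assumes "X \<in> carrier_mat 4 4" and "Y \<in> carrier_mat 4 4"
  shows "leg12 scale (six_vertex p t u v) * X = Y * leg12 scale (six_vertex p t u v) \<longleftrightarrow>
     scale p (X $$ (0,0)) = scale p (Y $$ (0,0)) \<and>
     scale p (X $$ (0,3)) = scale p (Y $$ (0,3)) \<and>
     scale p (X $$ (3,0)) = scale p (Y $$ (3,0)) \<and>
     scale p (X $$ (3,3)) = scale p (Y $$ (3,3)) \<and>
     scale p (X $$ (0,1)) = scale t (Y $$ (0,1)) + scale v (Y $$ (0,2)) \<and>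
     scale p (X $$ (0,2)) = scale u (Y $$ (0,1)) + scale t (Y $$ (0,2)) \<and>
     scale p (X $$ (3,1)) = scale t (Y $$ (3,1)) + scale v (Y $$ (3,2)) \<and>
     scale p (X $$ (3,2)) = scale u (Y $$ (3,1)) + scale t (Y $$ (3,2)) \<and>
     scale t (X $$ (1,0)) + scale u (X $$ (2,0)) = scale p (Y $$ (1,0)) \<and>
     scale v (X $$ (1,0)) + scale t (X $$ (2,0)) = scale p (Y $$ (2,0)) \<and>
     scale t (X $$ (1,3)) + scale u (X $$ (2,3)) = scale p (Y $$ (1,3)) \<and>
     scale v (X $$ (1,3)) + scale t (X $$ (2,3)) = scale p (Y $$ (2,3)) \<and>
     scale t (X $$ (1,1)) + scale u (X $$ (2,1)) = scale t (Y $$ (1,1)) + scale v (Y $$ (1,2)) \<and>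
     scale t (X $$ (1,2)) + scale u (X $$ (2,2)) = scale u (Y $$ (1,1)) + scale t (Y $$ (1,2)) \<and>
     scale v (X $$ (1,1)) + scale t (X $$ (2,1)) = scale t (Y $$ (2,1)) + scale v (Y $$ (2,2)) \<and>
     scale v (X $$ (1,2)) + scale t (X $$ (2,2)) = scale u (Y $$ (2,1)) + scale t (Y $$ (2,2))"
proof -
  define S where "S = leg12 scale (six_vertex p t u v)"
  have S: "S \<in> carrier_mat 4 4"
    by (intro carrier_matI) (simp_all add: S_def leg12_def six_vertex_def mat_of_rows_list_def)
  have entry: "(S * X) $$ (r, s) = (\<Sum>k<4. S $$ (r, k) * X $$ (k, s))"
    "(Y * S) $$ (r, s) = (\<Sum>k<4. Y $$ (r, k) * S $$ (k, s))" if "r < 4" "s < 4" for r s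
    using assms S that by (simp_all add: scalar_prod_def atLeast0LessThan)
  have S_entries:
    "S $$ (0,0) = scale p 1" "S $$ (0,1) = 0" "S $$ (0,2) = 0" "S $$ (0,3) = 0"
    "S $$ (1,0) = 0" "S $$ (1,1) = scale t 1" "S $$ (1,2) = scale u 1" "S $$ (1,3) = 0"
    "S $$ (2,0) = 0" "S $$ (2,1) = scale v 1" "S $$ (2,2) = scale t 1" "S $$ (2,3) = 0"
    "S $$ (3,0) = 0" "S $$ (3,1) = 0" "S $$ (3,2) = 0" "S $$ (3,3) = scale p 1"
    by (simp_all add: S_def leg12_def six_vertex_def mat_of_rows_list_def)
  have carriers: "S * X \<in> carrier_mat 4 4" "Y * S \<in> carrier_mat 4 4"
    using S assms by auto
  have "S * X = Y * S \<longleftrightarrow>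
    (\<forall>r\<in>{0,1,2,3}. \<forall>s\<in>{0,1,2,3}.
      (\<Sum>k<4. S $$ (r, k) * X $$ (k, s)) = (\<Sum>k<4. Y $$ (r, k) * S $$ (k, s)))"
    unfolding mat4_eq_iff[OF carriers] using entry by simp
  then show ?thesis
    unfolding S_def[symmetric]
    by (simp only: sum_lessThan_4 S_entries ball_simps scale_mult_left scale_mult_right
          mult_1_left mult_1_right mult_zero_left mult_zero_right add_0_left add_0_right simp_thms)
       blast
qed

lemma exchange_relation_entrywise:
  fixes a1 b1 c1 d1 a2 b2 c2 d2 :: 'a
  defines "G \<equiv> mat_of_rows_list 2 [[a1, b1], [c1, d1]]"
    and "H \<equiv> mat_of_rows_list 2 [[a2, b2], [c2, d2]]"
  shows "leg12 scale (six_vertex p t u v) * leg13 G * leg23 H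
       = leg23 H * leg13 G * leg12 scale (six_vertex p t u v) \<longleftrightarrow>
     scale p (a1 * a2) = scale p (a2 * a1) \<and>
     scale p (b1 * b2) = scale p (b2 * b1) \<and>
     scale p (c1 * c2) = scale p (c2 * c1) \<and>
     scale p (d1 * d2) = scale p (d2 * d1) \<and>
     scale p (a1 * b2) = scale t (b2 * a1) + scale v (a2 * b1) \<and>
     scale p (b1 * a2) = scale u (b2 * a1) + scale t (a2 * b1) \<and>
     scale p (c1 * d2) = scale t (d2 * c1) + scale v (c2 * d1) \<and>
     scale p (d1 * c2) = scale u (d2 * c1) + scale t (c2 * d1) \<and>
     scale t (a1 * c2) + scale u (c1 * a2) = scale p (c2 * a1) \<and>
     scale v (a1 * c2) + scale t (c1 * a2) = scale p (a2 * c1) \<and>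
     scale t (b1 * d2) + scale u (d1 * b2) = scale p (d2 * b1) \<and>
     scale v (b1 * d2) + scale t (d1 * b2) = scale p (b2 * d1) \<and>
     scale t (a1 * d2) + scale u (c1 * b2) = scale t (d2 * a1) + scale v (c2 * b1) \<and>
     scale t (b1 * c2) + scale u (d1 * a2) = scale u (d2 * a1) + scale t (c2 * b1) \<and>
     scale v (a1 * d2) + scale t (c1 * b2) = scale t (b2 * c1) + scale v (a2 * d1) \<and>
     scale v (b1 * c2) + scale t (d1 * a2) = scale u (b2 * c1) + scale t (a2 * d1)"
proof -
  let ?R = "leg12 scale (six_vertex p t u v)"
  have G: "G \<in> carrier_mat 2 2" and H: "H \<in> carrier_mat 2 2"
    by (intro carrier_matI; simp add: G_def H_def mat_of_rows_list_def)+
  have carriers: "leg13 G \<in> carrier_mat 4 4" "leg23 H \<in> carrier_mat 4 4" "?R \<in> carrier_mat 4 4"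
    using G H by (auto simp: leg13_def leg23_def kronecker_def)
      (intro carrier_matI; simp add: leg12_def six_vertex_def mat_of_rows_list_def)
  have entries: "G $$ (0, 0) = a1" "G $$ (0, Suc 0) = b1" "G $$ (Suc 0, 0) = c1"
    "G $$ (Suc 0, Suc 0) = d1" "H $$ (0, 0) = a2" "H $$ (0, Suc 0) = b2"
    "H $$ (Suc 0, 0) = c2" "H $$ (Suc 0, Suc 0) = d2"
    by (simp_all add: G_def H_def mat_of_rows_list_def)
  have "?R * leg13 G * leg23 H = ?R * (leg13 G * leg23 H)"
    using carriers by (simp add: assoc_mult_mat[of _ 4 4 _ 4 _ 4])
  moreover have "leg13 G * leg23 H \<in> carrier_mat 4 4" "leg23 H * leg13 G \<in> carrier_mat 4 4"
    using carriers by auto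
  ultimately show ?thesis
    by (simp only: leg12_six_vertex_intertwines_iff) (simp add: leg13_mult_leg23[OF G H]
        leg23_mult_leg13[OF G H] entries)
qed

section \<open>Solving the entry equations\<close>

text \<open>
  Moving the second \<open>x\<close> to the left gives \<open>(p - w) x = t y\<close>. The four conclusions cover the orders in
  which the terms occur in the rows and in the columns of the exchange relation; \<open>Z\<close> will be
  \<open>varpi l = 0\<close>, to which \<open>t = 0\<close> reduces once the monomial factors in the spectral parameters
  are dropped.
\<close>

lemma q_exchange_iff:
  assumes "(p - w) * k = t" and "k \<noteq> 0" and "t = 0 \<longleftrightarrow> Z"
  shows "scale p x = scale t y + scale w x \<longleftrightarrow> Z \<or> x = scale k y"
    and "scale t y + scale w x = scale p x \<longleftrightarrow> Z \<or> x = scale k y"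
    and "scale p x = scale w x + scale t y \<longleftrightarrow> Z \<or> x = scale k y"
    and "scale w x + scale t y = scale p x \<longleftrightarrow> Z \<or> x = scale k y"
proof -
  have "scale p x = scale t y + scale w x \<longleftrightarrow> scale (p - w) x = scale (p - w) (scale k y)"
    using assms(1) by (auto simp: scale_left_diff_distrib algebra_simps)
  also have "\<dots> \<longleftrightarrow> p - w = 0 \<or> x = scale k y"
    unfolding scale_cancel_left by blast
  also have "p - w = 0 \<longleftrightarrow> Z"
    using assms by auto
  finally show "scale p x = scale t y + scale w x \<longleftrightarrow> Z \<or> x = scale k y" .
  then show "scale t y + scale w x = scale p x \<longleftrightarrow> Z \<or> x = scale k y"
    "scale p x = scale w x + scale t y \<longleftrightarrow> Z \<or> x = scale k y"
    "scale w x + scale t y = scale p x \<longleftrightarrow> Z \<or> x = scale k y"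
    by (metis add.commute)+
qed

text \<open>
  The mirror case, in which the repeated term is \<open>y\<close>; it amounts to the relation
  \<open>y = k\<inverse> x\<close>.
\<close>

lemma q_exchange_iff':
  assumes "p - w = t * k" and "k \<noteq> 0" and "t = 0 \<longleftrightarrow> Z"
  shows "scale p y = scale t x + scale w y \<longleftrightarrow> Z \<or> x = scale k y"
    and "scale t x + scale w y = scale p y \<longleftrightarrow> Z \<or> x = scale k y"
    and "scale p y = scale w y + scale t x \<longleftrightarrow> Z \<or> x = scale k y"
    and "scale w y + scale t x = scale p y \<longleftrightarrow> Z \<or> x = scale k y"
proof -
  have "(p - w) * inverse k = t" "inverse k \<noteq> 0" using assms(1,2) by simp_all
  note * = q_exchange_iff[OF this assms(3)]
  have "y = scale (inverse k) x \<longleftrightarrow> x = scale k y" using assms(2) by auto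
  then show "scale p y = scale t x + scale w y \<longleftrightarrow> Z \<or> x = scale k y"
    "scale t x + scale w y = scale p y \<longleftrightarrow> Z \<or> x = scale k y"
    "scale p y = scale w y + scale t x \<longleftrightarrow> Z \<or> x = scale k y"
    "scale w y + scale t x = scale p y \<longleftrightarrow> Z \<or> x = scale k y"
    unfolding * by simp_all
qed

text \<open>
  In the central block the two terms in \<open>z\<close> combine to \<open>(v - u) z\<close>. The coefficients \<open>t\<close> and \<open>t'\<close>
  are kept apart because they arise as products of spectral parameters in different orders.
\<close>

lemma commutator_exchange_iff:
  assumes "v - u = t * k" and "t' = t" and "t = 0 \<longleftrightarrow> Z"
  shows "scale t x + scale u z = scale t' y + scale v z \<longleftrightarrow> Z \<or> x - y = scale k z"
    and "scale u z + scale t x = scale t' y + scale v z \<longleftrightarrow> Z \<or> x - y = scale k z"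
    and "scale t' y + scale v z = scale u z + scale t x \<longleftrightarrow> Z \<or> x - y = scale k z"
    and "scale v z + scale t' y = scale u z + scale t x \<longleftrightarrow> Z \<or> x - y = scale k z"
proof -
  have "scale t x + scale u z = scale t' y + scale v z \<longleftrightarrow> scale t (x - y) = scale (v - u) z"
    unfolding assms(2)
    by (auto simp: scale_left_diff_distrib scale_right_diff_distrib algebra_simps)
  also have "\<dots> \<longleftrightarrow> scale t (x - y) = scale t (scale k z)"
    by (simp add: assms(1))
  also have "\<dots> \<longleftrightarrow> Z \<or> x - y = scale k z"
    unfolding scale_cancel_left assms(3) by blast
  finally show "scale t x + scale u z = scale t' y + scale v z \<longleftrightarrow> Z \<or> x - y = scale k z" .
  then show "scale u z + scale t x = scale t' y + scale v z \<longleftrightarrow> Z \<or> x - y = scale k z"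
    "scale t' y + scale v z = scale u z + scale t x \<longleftrightarrow> Z \<or> x - y = scale k z"
    "scale v z + scale t' y = scale u z + scale t x \<longleftrightarrow> Z \<or> x - y = scale k z"
    by (metis add.commute)+
qed

lemma commuting_exchange_iff:
  assumes "v = u" and "t' = t" and "t = 0 \<longleftrightarrow> Z"
  shows "scale t x + scale u z = scale t' y + scale v z \<longleftrightarrow> Z \<or> x = y"
    and "scale t x + scale u z = scale v z + scale t' y \<longleftrightarrow> Z \<or> x = y"
    and "scale u z + scale t x = scale t' y + scale v z \<longleftrightarrow> Z \<or> x = y"
    and "scale u z + scale t x = scale v z + scale t' y \<longleftrightarrow> Z \<or> x = y"
proof -
  have "v - u = t * 0" using assms(1) by simp
  from commutator_exchange_iff(1)[OF this assms(2,3)]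
  show "scale t x + scale u z = scale t' y + scale v z \<longleftrightarrow> Z \<or> x = y" by simp
  then show "scale t x + scale u z = scale v z + scale t' y \<longleftrightarrow> Z \<or> x = y"
    "scale u z + scale t x = scale t' y + scale v z \<longleftrightarrow> Z \<or> x = y"
    "scale u z + scale t x = scale v z + scale t' y \<longleftrightarrow> Z \<or> x = y"
    by (simp_all only: add.commute)
qed

section \<open>The two exchange relations at fixed spectral parameters\<close>

text \<open>
  The conjunction displayed in the proof is the table of what each entry equation says.
\<close>

lemma exchange_relation_g_mat_iff:
  assumes "q \<noteq> 0" and "l \<noteq> 0" and "m \<noteq> 0"
  shows "leg12 scale (R_mat q l) * leg13 (g_mat scale a b c d (l * m)) * leg23 (g_mat scale a b c d m)
       = leg23 (g_mat scale a b c d m) * leg13 (g_mat scale a b c d (l * m)) * leg12 scale (R_mat q l)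
     \<longleftrightarrow> varpi l = 0 \<or> GLq2_relations scale q a b c d"
    (is "?exchange \<longleftrightarrow> _")
proof -
  let ?Z = "varpi l = 0"
  have "?exchange \<longleftrightarrow> True \<and> True \<and> True \<and> True
      \<and> (?Z \<or> a * b = scale q (b * a))
      \<and> (?Z \<or> a * b = scale q (b * a))
      \<and> (?Z \<or> c * d = scale q (d * c))
      \<and> (?Z \<or> c * d = scale q (d * c))
      \<and> (?Z \<or> a * c = scale q (c * a))
      \<and> (?Z \<or> a * c = scale q (c * a))
      \<and> (?Z \<or> b * d = scale q (d * b))
      \<and> (?Z \<or> b * d = scale q (d * b))
      \<and> (?Z \<or> a * d - d * a = scale (q - inverse q) (c * b))
      \<and> (?Z \<or> b * c = c * b)
      \<and> (?Z \<or> c * b = b * c)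
      \<and> (?Z \<or> a * d - d * a = scale (q - inverse q) (b * c))"
    unfolding g_mat_def R_mat_def six_vertex_def[symmetric] exchange_relation_entrywise
      scale_mult_left scale_mult_right scale_scale
    \<comment> \<open>The rules leave only identities between the scalar coefficients.\<close>
    by (intro arg_cong2[where f = "(\<and>)"];
        (simp only: mult_ac; fail)?;
        (rule q_exchange_iff q_exchange_iff' commutator_exchange_iff commuting_exchange_iff)?;
        simp add: assms varpi_def field_simps)
  also have "\<dots> \<longleftrightarrow> ?Z \<or> GLq2_relations scale q a b c d"
    unfolding GLq2_relations_def commutator_def by auto
  finally show ?thesis .
qed

text \<open>
  Each row of \<open>g_hat\<close> has a single power of the spectral parameter, so the products of entries carry
  other powers of \<open>l\<close> than those of \<open>g_mat\<close>. The unequal off-diagonal weights of \<open>R_hat\<close> compensate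
  for this: the table contains the same relations in a different order.
\<close>

lemma exchange_relation_g_hat_iff:
  assumes "q \<noteq> 0" and "l \<noteq> 0" and "m \<noteq> 0"
  shows "leg12 scale (R_hat q l) * leg13 (g_hat scale a b c d (l * m)) * leg23 (g_hat scale a b c d m)
       = leg23 (g_hat scale a b c d m) * leg13 (g_hat scale a b c d (l * m)) * leg12 scale (R_hat q l)
     \<longleftrightarrow> varpi l = 0 \<or> GLq2_relations scale q a b c d"
    (is "?exchange \<longleftrightarrow> _")
proof -
  let ?Z = "varpi l = 0"
  have "?exchange \<longleftrightarrow> True \<and> True \<and> True \<and> True
      \<and> (?Z \<or> c * d = scale q (d * c))
      \<and> (?Z \<or> c * d = scale q (d * c))
      \<and> (?Z \<or> a * b = scale q (b * a))
      \<and> (?Z \<or> a * b = scale q (b * a))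
      \<and> (?Z \<or> a * c = scale q (c * a))
      \<and> (?Z \<or> a * c = scale q (c * a))
      \<and> (?Z \<or> b * d = scale q (d * b))
      \<and> (?Z \<or> b * d = scale q (d * b))
      \<and> (?Z \<or> c * b = b * c)
      \<and> (?Z \<or> a * d - d * a = scale (q - inverse q) (b * c))
      \<and> (?Z \<or> a * d - d * a = scale (q - inverse q) (c * b))
      \<and> (?Z \<or> b * c = c * b)"
    unfolding g_hat_def R_hat_def six_vertex_def[symmetric] exchange_relation_entrywise
      scale_mult_left scale_mult_right scale_scale
    \<comment> \<open>The rules leave only identities between the scalar coefficients.\<close>
    by (intro arg_cong2[where f = "(\<and>)"];
        (simp only: mult_ac; fail)?;
        (rule q_exchange_iff q_exchange_iff' commutator_exchange_iff commuting_exchange_iff)?;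
        simp add: assms varpi_def field_simps)
  also have "\<dots> \<longleftrightarrow> ?Z \<or> GLq2_relations scale q a b c d"
    unfolding GLq2_relations_def commutator_def by auto
  finally show ?thesis .
qed

end

theorem proposition1:
  fixes scale :: "complex \<Rightarrow> 'a::{ring, monoid_mult} \<Rightarrow> 'a"
    and a b c d :: 'a
    and \<gamma> :: real
    and q :: complex
  assumes "complex_algebra scale"
    and "0 < \<gamma>" and "\<gamma> < pi"
    and "q = exp (\<i> * complex_of_real \<gamma>)"
  shows
    "((\<forall>l m. l \<noteq> 0 \<longrightarrow> m \<noteq> 0 \<longrightarrow>
        leg12 scale (R_mat q l) * leg13 (g_mat scale a b c d (l * m)) * leg23 (g_mat scale a b c d m)
        = leg23 (g_mat scale a b c d m) * leg13 (g_mat scale a b c d (l * m)) * leg12 scale (R_mat q l))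
     \<longleftrightarrow> GLq2_relations scale q a b c d) \<and>
     ((\<forall>l m. l \<noteq> 0 \<longrightarrow> m \<noteq> 0 \<longrightarrow>
        leg12 scale (R_hat q l) * leg13 (g_hat scale a b c d (l * m)) * leg23 (g_hat scale a b c d m)
        = leg23 (g_hat scale a b c d m) * leg13 (g_hat scale a b c d (l * m)) * leg12 scale (R_hat q l))
     \<longleftrightarrow> GLq2_relations scale q a b c d)"
proof -
  interpret complex_algebra scale by fact
  have q: "q \<noteq> 0" using assms(4) by simp
  have reduce: "(\<forall>l m. l \<noteq> 0 \<longrightarrow> m \<noteq> 0 \<longrightarrow> E l m) \<longleftrightarrow> Q"
    if E: "\<And>l m. l \<noteq> 0 \<Longrightarrow> m \<noteq> 0 \<Longrightarrow> E l m \<longleftrightarrow> varpi l = 0 \<or> Q"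
    for E :: "complex \<Rightarrow> complex \<Rightarrow> bool" and Q
  proof -
    \<comment> \<open>Any \<open>l\<close> other than \<open>0\<close>, \<open>1\<close>, \<open>-1\<close> would do, with any nonzero \<open>m\<close>.\<close>
    have "E 2 1 \<longleftrightarrow> Q" using E[of 2 1] by (simp add: varpi_def)
    with E show ?thesis by (metis one_neq_zero zero_neq_numeral)
  qed
  show ?thesis
    by (intro conjI reduce exchange_relation_g_mat_iff exchange_relation_g_hat_iff q)
qed

end
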